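(* Let $(V^\bullet,\diamond,\pi)$ be a weak comp algebra over a field $k$. Then $V=\bigoplus_{i\ge0}V^i$ is a (non-unital) graded associative algebra with respect to each of the two operations $\cup,\sqcup:V^m\otimes V^n\to V^{m+n}$ defined, for $f\in V^m$, $g\in V^n$, by $$f\cup g=(\pi\diamond_0f)\diamond_mg,\qquad f\sqcup g=(\pi\diamond_1g)\diamond_0f.$$
   Context: A (right) weak comp algebra $(V^\bullet,\diamond,\pi)$ over a field $k$ consists of a sequence of vector spaces $V^0,V^1,V^2,\ldots$, an element $\pi\in V^2$ and $k$-linear operations $\diamond_i:V^m\otimes V^n\to V^{m+n-1}$ for $i\ge0$ (with $V^{-1}=0$ understood) such that for any $f\in V^m$, $g\in V^n$, $h\in V^p$: (1) $f\diamond_ig=0$ if $i>m-1$; (2) $(f\diamond_ig)\diamond_jh=f\diamond_i(g\diamond_{j-i}h)$ if $i\le j<n+i$; (3) if either $g=\pi$ or $h=\pi$, then $(f\diamond_ig)\diamond_jh=(f\diamond_jh)\diamond_{i+p-1}g$ if $j<i$; (4) $\pi\diamond_0\pi=\pi\diamond_1\pi$. *)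

theory Defs
  imports "HOL-Algebra.Module"
begin

text \<open>
  Vector spaces over a field \<open>K\<close> are modules (in the sense of HOL-Algebra) over \<open>K\<close> with
  \<open>field K\<close>. The multiplicative fields of the module record play no role in \<open>module\<close>; below
  they are only used where an object carries a product.

  A linear map out of a tensor product is represented by the corresponding bilinear map.
\<close>

locale bilinear_map = M: module K M + N: module K N + P: module K P
  for K and M and N and P +
  fixes b :: "'m \<Rightarrow> 'n \<Rightarrow> 'p"
  assumes closed: "x \<in> carrier M \<Longrightarrow> y \<in> carrier N \<Longrightarrow> b x y \<in> carrier P"
    and add_left: "x \<in> carrier M \<Longrightarrow> x' \<in> carrier M \<Longrightarrow> y \<in> carrier N \<Longrightarrow>
      b (x \<oplus>\<^bsub>M\<^esub> x') y = b x y \<oplus>\<^bsub>P\<^esub> b x' y"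
    and add_right: "x \<in> carrier M \<Longrightarrow> y \<in> carrier N \<Longrightarrow> y' \<in> carrier N \<Longrightarrow>
      b x (y \<oplus>\<^bsub>N\<^esub> y') = b x y \<oplus>\<^bsub>P\<^esub> b x y'"
    and smult_left: "a \<in> carrier K \<Longrightarrow> x \<in> carrier M \<Longrightarrow> y \<in> carrier N \<Longrightarrow>
      b (a \<odot>\<^bsub>M\<^esub> x) y = a \<odot>\<^bsub>P\<^esub> b x y"
    and smult_right: "a \<in> carrier K \<Longrightarrow> x \<in> carrier M \<Longrightarrow> y \<in> carrier N \<Longrightarrow>
      b x (a \<odot>\<^bsub>N\<^esub> y) = a \<odot>\<^bsub>P\<^esub> b x y"

text \<open>
  The sequence of spaces is indexed by \<open>int\<close>, with zero spaces in negative degrees, so that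
  the target degree \<open>m + n - 1\<close> needs no truncated subtraction. Extending the operations to
  negative degrees is no extra data, as they can only be zero there.

  \<open>comp m n i f g\<close> is the operation of index \<open>i\<close> applied to \<open>f\<close> of degree \<open>m\<close> and \<open>g\<close> of degree
  \<open>n\<close>. The degrees are explicit arguments because the carriers of the spaces need not be disjoint
  as sets; for the same reason ``\<open>g\<close> is the distinguished element'' includes the condition that
  the degree is 2.

  In the third axiom the difference \<open>i + p - 1\<close> on \<open>nat\<close> is exact, since \<open>j < i\<close>.
\<close>

locale weak_comp_algebra =
  fixes K :: "('k, 'r) ring_scheme"
    and V :: "int \<Rightarrow> ('k, 'v) module"
    and comp :: "int \<Rightarrow> int \<Rightarrow> nat \<Rightarrow> 'v \<Rightarrow> 'v \<Rightarrow> 'v"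
    and \<pi> :: 'v
  assumes field: "field K"
    and vector_space: "\<And>n. module K (V n)"
    and negative_degree: "\<And>n. n < 0 \<Longrightarrow> carrier (V n) = {\<zero>\<^bsub>V n\<^esub>}"
    and pi_degree: "\<pi> \<in> carrier (V 2)"
    and comp_bilinear: "\<And>m n i. bilinear_map K (V m) (V n) (V (m + n - 1)) (comp m n i)"
    and comp_eq_zero:
      "f \<in> carrier (V (int m)) \<Longrightarrow> g \<in> carrier (V (int n)) \<Longrightarrow> int i > int m - 1 \<Longrightarrow>
        comp (int m) (int n) i f g = \<zero>\<^bsub>V (int m + int n - 1)\<^esub>"
    and comp_assoc:
      "f \<in> carrier (V (int m)) \<Longrightarrow> g \<in> carrier (V (int n)) \<Longrightarrow> h \<in> carrier (V (int p)) \<Longrightarrow>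
        i \<le> j \<Longrightarrow> j < n + i \<Longrightarrow>
        comp (int m + int n - 1) (int p) j (comp (int m) (int n) i f g) h
          = comp (int m) (int n + int p - 1) i f (comp (int n) (int p) (j - i) g h)"
    and comp_commute:
      "f \<in> carrier (V (int m)) \<Longrightarrow> g \<in> carrier (V (int n)) \<Longrightarrow> h \<in> carrier (V (int p)) \<Longrightarrow>
        (n = 2 \<and> g = \<pi>) \<or> (p = 2 \<and> h = \<pi>) \<Longrightarrow> j < i \<Longrightarrow>
        comp (int m + int n - 1) (int p) j (comp (int m) (int n) i f g) h
          = comp (int m + int p - 1) (int n) (i + p - 1) (comp (int m) (int p) j f h) g"
    and pi_comp_pi: "comp 2 2 0 \<pi> \<pi> = comp 2 2 1 \<pi> \<pi>"
begin

definition cup :: "nat \<Rightarrow> nat \<Rightarrow> 'v \<Rightarrow> 'v \<Rightarrow> 'v" where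
  "cup m n f g = comp (int m + 1) (int n) m (comp 2 (int m) 0 \<pi> f) g"

definition sqcup :: "nat \<Rightarrow> nat \<Rightarrow> 'v \<Rightarrow> 'v \<Rightarrow> 'v" where
  "sqcup m n f g = comp (int n + 1) (int m) 0 (comp 2 (int n) 1 \<pi> g) f"

end

text \<open>
  Associative algebras, not assumed to be unital (the field \<open>one\<close> of the record is ignored) or
  commutative, in contrast to the locale \<open>algebra\<close> of HOL-Algebra.
\<close>

locale nonunital_algebra = module K A for K and A (structure) +
  assumes field: "field K"
    and mult_bilinear: "bilinear_map K A A A (\<otimes>)"
    and mult_assoc: "x \<in> carrier A \<Longrightarrow> y \<in> carrier A \<Longrightarrow> z \<in> carrier A \<Longrightarrow>
      (x \<otimes> y) \<otimes> z = x \<otimes> (y \<otimes> z)"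

locale graded_nonunital_algebra = nonunital_algebra K A for K and A (structure) +
  fixes G :: "nat \<Rightarrow> _ set"
  assumes component_submodule: "submodule (G n) K A"
    and decomposition: "x \<in> carrier A \<Longrightarrow>
      \<exists>!c. (\<forall>n. c n \<in> G n) \<and> finite {n. c n \<noteq> \<zero>} \<and> x = (\<Oplus>n\<in>{n. c n \<noteq> \<zero>}. c n)"
    and mult_graded: "x \<in> G m \<Longrightarrow> y \<in> G n \<Longrightarrow> x \<otimes> y \<in> G (m + n)"

text \<open>
  The direct sum of the \<open>W n\<close>, with the product whose value on homogeneous elements of degrees
  \<open>m\<close> and \<open>n\<close> is given by \<open>\<mu> m n\<close> (see \<open>direct_sum_mult_homogeneous\<close> below).
\<close>

definition direct_sum_algebra ::
  "(nat \<Rightarrow> ('k, 'v) module) \<Rightarrow> (nat \<Rightarrow> nat \<Rightarrow> 'v \<Rightarrow> 'v \<Rightarrow> 'v) \<Rightarrow> ('k, nat \<Rightarrow> 'v) module" where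
  "direct_sum_algebra W \<mu> =
    \<lparr>carrier = {x. (\<forall>n. x n \<in> carrier (W n)) \<and> finite {n. x n \<noteq> \<zero>\<^bsub>W n\<^esub>}},
     mult = (\<lambda>x y n. \<Oplus>\<^bsub>W n\<^esub>i\<in>{..n}. \<mu> i (n - i) (x i) (y (n - i))),
     one = undefined,
     zero = (\<lambda>n. \<zero>\<^bsub>W n\<^esub>),
     add = (\<lambda>x y n. x n \<oplus>\<^bsub>W n\<^esub> y n),
     smult = (\<lambda>a x n. a \<odot>\<^bsub>W n\<^esub> x n)\<rparr>"

definition direct_sum_inj :: "(nat \<Rightarrow> ('k, 'v) module) \<Rightarrow> nat \<Rightarrow> 'v \<Rightarrow> nat \<Rightarrow> 'v" where
  "direct_sum_inj W m f = (\<lambda>n. if n = m then f else \<zero>\<^bsub>W n\<^esub>)"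

definition direct_sum_component :: "(nat \<Rightarrow> ('k, 'v) module) \<Rightarrow> nat \<Rightarrow> (nat \<Rightarrow> 'v) set" where
  "direct_sum_component W m = direct_sum_inj W m ` carrier (W m)"

lemma (in bilinear_map) zero_left:
  assumes "y \<in> carrier N" shows "b \<zero>\<^bsub>M\<^esub> y = \<zero>\<^bsub>P\<^esub>"
  using add_left[of "\<zero>\<^bsub>M\<^esub>" "\<zero>\<^bsub>M\<^esub>" y] assms closed[of "\<zero>\<^bsub>M\<^esub>" y]
  by (metis M.M.l_zero M.M.zero_closed P.add.r_cancel_one')

lemma (in bilinear_map) zero_right:
  assumes "x \<in> carrier M" shows "b x \<zero>\<^bsub>N\<^esub> = \<zero>\<^bsub>P\<^esub>"
  using add_right[of x "\<zero>\<^bsub>N\<^esub>" "\<zero>\<^bsub>N\<^esub>"] assms closed[of x "\<zero>\<^bsub>N\<^esub>"]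
  by (metis N.M.l_zero N.M.zero_closed P.add.r_cancel_one')

lemma direct_sum_mult_homogeneous:
  assumes bil: "\<And>m n. bilinear_map K (W m) (W n) (W (m + n)) (\<mu> m n)"
    and f: "f \<in> carrier (W m)" and g: "g \<in> carrier (W n)"
  shows "direct_sum_inj W m f \<otimes>\<^bsub>direct_sum_algebra W \<mu>\<^esub> direct_sum_inj W n g
    = direct_sum_inj W (m + n) (\<mu> m n f g)"
proof
  fix k
  let ?t = "\<lambda>i. \<mu> i (k - i) (direct_sum_inj W m f i) (direct_sum_inj W n g (k - i))"
  have mods: "module K (W i)" for i
    using bil[of i i] by (simp add: bilinear_map_def)
  have zero: "\<zero>\<^bsub>W i\<^esub> \<in> carrier (W i)" for i
    using mods[of i] by (simp add: module_def abelian_group_def abelian_monoid.zero_closed)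
  have ab: "abelian_monoid (W k)"
    using mods[of k] by (simp add: module_def abelian_group_def)
  have inj: "direct_sum_inj W m f i \<in> carrier (W i)" "direct_sum_inj W n g i \<in> carrier (W i)" for i
    using f g zero by (auto simp: direct_sum_inj_def)
  have t0: "?t i = \<zero>\<^bsub>W k\<^esub>" if "i \<le> k" "i \<noteq> m \<or> k \<noteq> m + n" for i
  proof (cases "i = m")
    case False
    then show ?thesis
      using bilinear_map.zero_left[OF bil[of i "k - i"] inj(2)] that
      by (simp add: direct_sum_inj_def)
  next
    case True
    then have "k - i \<noteq> n" using that by auto
    then show ?thesis
      using bilinear_map.zero_right[OF bil[of i "k - i"] inj(1)] that
      by (simp add: direct_sum_inj_def)
  qed
  have "(\<Oplus>\<^bsub>W k\<^esub>i\<in>{..k}. ?t i) = direct_sum_inj W (m + n) (\<mu> m n f g) k"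
  proof (cases "k = m + n")
    case True
    have c: "\<mu> m n f g \<in> carrier (W k)"
      using bilinear_map.closed[OF bil f g] True by simp
    have "(\<Oplus>\<^bsub>W k\<^esub>i\<in>{..k}. ?t i) = (\<Oplus>\<^bsub>W k\<^esub>i\<in>{..k}. if m = i then \<mu> m n f g else \<zero>\<^bsub>W k\<^esub>)"
    proof (rule abelian_monoid.finsum_cong'[OF ab])
      show "?t i = (if m = i then \<mu> m n f g else \<zero>\<^bsub>W k\<^esub>)" if "i \<in> {..k}" for i
        using t0[of i] that True by (auto simp: direct_sum_inj_def)
    qed (use c zero in auto)
    also have "\<dots> = \<mu> m n f g"
      using abelian_monoid.finsum_singleton[OF ab, of m "{..k}" "\<lambda>_. \<mu> m n f g"] c True by simp
    finally show ?thesis using True by (simp add: direct_sum_inj_def)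
  next
    case False
    have "(\<Oplus>\<^bsub>W k\<^esub>i\<in>{..k}. ?t i) = (\<Oplus>\<^bsub>W k\<^esub>i\<in>{..k}. \<zero>\<^bsub>W k\<^esub>)"
      by (rule abelian_monoid.finsum_cong'[OF ab]) (use t0 False zero in auto)
    then show ?thesis
      using False by (simp add: direct_sum_inj_def abelian_monoid.finsum_zero[OF ab])
  qed
  then show "(direct_sum_inj W m f \<otimes>\<^bsub>direct_sum_algebra W \<mu>\<^esub> direct_sum_inj W n g) k
    = direct_sum_inj W (m + n) (\<mu> m n f g) k"
    by (simp add: direct_sum_algebra_def)
qed

end

theory Submission
  imports Defs
begin

text \<open>
  Since \<open>\<pi> \<diamond>\<^sub>0 \<pi> = \<pi> \<diamond>\<^sub>1 \<pi>\<close>, axioms (2) and (3) give \<open>\<pi> \<diamond>\<^sub>0 (\<pi> \<diamond>\<^sub>0 f) = (\<pi> \<diamond>\<^sub>0 f) \<diamond>\<^sub>m \<pi>\<close>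
  for \<open>f\<close> of degree \<open>m\<close>. Writing \<open>F = \<pi> \<diamond>\<^sub>0 f\<close> and \<open>G = \<pi> \<diamond>\<^sub>0 g\<close>, axiom (2) turns both
  \<open>(f \<union> g) \<union> h\<close> and \<open>f \<union> (g \<union> h)\<close> into \<open>(F \<diamond>\<^sub>m G) \<diamond>\<^bsub>m+n\<^esub> h\<close>. For the other product the same
  argument is run with \<open>\<pi> \<diamond>\<^sub>1 (\<pi> \<diamond>\<^sub>1 h) = (\<pi> \<diamond>\<^sub>1 h) \<diamond>\<^sub>0 \<pi>\<close>.
\<close>

section \<open>Finite sums: reindexing and bilinearity\<close>

text \<open>Both sides sum over the triangle of all \<open>i + j \<le> n\<close>, once by
  antidiagonals and once by rows. Going from \<open>n\<close> to \<open>Suc n\<close> adds one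
  antidiagonal, which gives each old row one new entry and opens one new row.\<close>

lemma (in abelian_monoid) finsum_triangle:
  fixes n :: nat
  assumes "\<And>i j. i + j \<le> n \<Longrightarrow> g i j \<in> carrier G"
  shows "(\<Oplus>k\<in>{..n}. \<Oplus>i\<in>{..k}. g i (k - i)) = (\<Oplus>i\<in>{..n}. \<Oplus>j\<in>{..n - i}. g i j)"
  using assms
proof (induction n)
  case 0
  then show ?case by simp
next
  case (Suc n)
  have row: "(\<Oplus>j\<in>{..Suc n - i}. g i j) = g i (Suc n - i) \<oplus> (\<Oplus>j\<in>{..n - i}. g i j)"
    if "i \<le> n" for i
    using that Suc.prems by (simp add: Suc_diff_le Pi_def)
  have "(\<Oplus>k\<in>{..Suc n}. \<Oplus>i\<in>{..k}. g i (k - i))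
      = (\<Oplus>i\<in>{..Suc n}. g i (Suc n - i)) \<oplus> (\<Oplus>k\<in>{..n}. \<Oplus>i\<in>{..k}. g i (k - i))"
    using Suc.prems by (intro finsum_Suc) (auto intro!: finsum_closed)
  \<comment> \<open>The term \<open>i = Suc n\<close> of the new antidiagonal is split off: it alone
    forms the new row. The other terms are matched with the old rows
    \<open>i \<le> n\<close>.\<close>
  also have "\<dots> = g (Suc n) 0 \<oplus> (\<Oplus>i\<in>{..n}. g i (Suc n - i)) \<oplus> (\<Oplus>i\<in>{..n}. \<Oplus>j\<in>{..n - i}. g i j)"
    using Suc.prems by (simp add: Suc.IH Pi_def)
  also have "\<dots> = g (Suc n) 0 \<oplus> (\<Oplus>i\<in>{..n}. g i (Suc n - i) \<oplus> (\<Oplus>j\<in>{..n - i}. g i j))"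
    using Suc.prems by (subst finsum_addf) (auto intro!: finsum_closed simp: a_assoc)
  also have "\<dots> = g (Suc n) 0 \<oplus> (\<Oplus>i\<in>{..n}. \<Oplus>j\<in>{..Suc n - i}. g i j)"
    using Suc.prems
    by (intro arg_cong2[where f = "(\<oplus>)"] refl finsum_cong') (auto simp: row intro!: finsum_closed)
  also have "\<dots> = (\<Oplus>i\<in>{..Suc n}. \<Oplus>j\<in>{..Suc n - i}. g i j)"
    using Suc.prems by (subst finsum_Suc) (auto intro!: finsum_closed)
  finally show ?case .
qed

context bilinear_map
begin

lemma finsum_left:
  assumes "finite S" "f \<in> S \<rightarrow> carrier M" "y \<in> carrier N"
  shows "b (\<Oplus>\<^bsub>M\<^esub>i\<in>S. f i) y = (\<Oplus>\<^bsub>P\<^esub>i\<in>S. b (f i) y)"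
  using assms
  by (induction S rule: finite_induct)
    (auto simp: zero_left add_left closed Pi_def intro!: M.M.finsum_closed)

lemma finsum_right:
  assumes "finite S" "f \<in> S \<rightarrow> carrier N" "x \<in> carrier M"
  shows "b x (\<Oplus>\<^bsub>N\<^esub>i\<in>S. f i) = (\<Oplus>\<^bsub>P\<^esub>i\<in>S. b x (f i))"
  using assms
  by (induction S rule: finite_induct)
    (auto simp: zero_right add_right closed Pi_def intro!: N.M.finsum_closed)

end

section \<open>The direct sum algebra of a degreewise product\<close>

text \<open>This isolates what the two products have in common, so that the passage from homogeneous
  elements to the direct sum is made only once.\<close>

locale graded_product =
  fixes K :: "('k, 'r) ring_scheme"
    and W :: "nat \<Rightarrow> ('k, 'v) module"
    and \<mu> :: "nat \<Rightarrow> nat \<Rightarrow> 'v \<Rightarrow> 'v \<Rightarrow> 'v"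
  assumes field: "field K"
    and bilinear: "bilinear_map K (W m) (W n) (W (m + n)) (\<mu> m n)"
    and assoc: "f \<in> carrier (W m) \<Longrightarrow> g \<in> carrier (W n) \<Longrightarrow> h \<in> carrier (W p) \<Longrightarrow>
      \<mu> (m + n) p (\<mu> m n f g) h = \<mu> m (n + p) f (\<mu> n p g h)"
begin

sublocale W: module K "W n" for n
  using bilinear[of n n] by (simp add: bilinear_map_def)

abbreviation A where "A \<equiv> direct_sum_algebra W \<mu>"

lemma carrier_iff:
  "x \<in> carrier A \<longleftrightarrow> (\<forall>n. x n \<in> carrier (W n)) \<and> finite {n. x n \<noteq> \<zero>\<^bsub>W n\<^esub>}"
  by (simp add: direct_sum_algebra_def)

lemma add_eq: "x \<oplus>\<^bsub>A\<^esub> y = (\<lambda>n. x n \<oplus>\<^bsub>W n\<^esub> y n)"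
  and zero_eq: "\<zero>\<^bsub>A\<^esub> = (\<lambda>n. \<zero>\<^bsub>W n\<^esub>)"
  and smult_eq: "a \<odot>\<^bsub>A\<^esub> x = (\<lambda>n. a \<odot>\<^bsub>W n\<^esub> x n)"
  and mult_eq: "x \<otimes>\<^bsub>A\<^esub> y = (\<lambda>n. \<Oplus>\<^bsub>W n\<^esub>i\<in>{..n}. \<mu> i (n - i) (x i) (y (n - i)))"
  by (simp_all add: direct_sum_algebra_def)

lemma component_closed: "x \<in> carrier A \<Longrightarrow> x n \<in> carrier (W n)"
  by (simp add: carrier_iff)

text \<open>The target degree \<open>k\<close> is a separate variable so that factors of degrees
  \<open>i\<close> and \<open>n - i\<close> fit a goal about \<open>W n\<close>, leaving only an
  equation between degrees.\<close>

lemma product_closed: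
  assumes "f \<in> carrier (W m)" "g \<in> carrier (W n)" "k = m + n"
  shows "\<mu> m n f g \<in> carrier (W k)"
  using bilinear_map.closed[OF bilinear] assms by blast

lemma add_closed:
  assumes "x \<in> carrier A" "y \<in> carrier A"
  shows "x \<oplus>\<^bsub>A\<^esub> y \<in> carrier A"
proof -
  have "{n. x n \<oplus>\<^bsub>W n\<^esub> y n \<noteq> \<zero>\<^bsub>W n\<^esub>} \<subseteq> {n. x n \<noteq> \<zero>\<^bsub>W n\<^esub>} \<union> {n. y n \<noteq> \<zero>\<^bsub>W n\<^esub>}"
    by auto
  then show ?thesis
    using assms by (auto simp: carrier_iff add_eq intro: finite_subset)
qed

lemma smult_closed:
  assumes "a \<in> carrier K" "x \<in> carrier A"
  shows "a \<odot>\<^bsub>A\<^esub> x \<in> carrier A"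
proof -
  have "{n. a \<odot>\<^bsub>W n\<^esub> x n \<noteq> \<zero>\<^bsub>W n\<^esub>} \<subseteq> {n. x n \<noteq> \<zero>\<^bsub>W n\<^esub>}"
    using assms(1) by auto
  then show ?thesis
    using assms by (auto simp: carrier_iff smult_eq intro: finite_subset)
qed

text \<open>Negatives are written componentwise because \<open>A\<close> is not yet known to be a
  group. They are the witnesses for inverses in \<open>module_direct_sum\<close>;
  \<open>uminus_eq\<close> identifies them with negation in \<open>A\<close> afterwards.\<close>

lemma uminus_closed:
  assumes "x \<in> carrier A"
  shows "(\<lambda>n. \<ominus>\<^bsub>W n\<^esub> x n) \<in> carrier A"
proof -
  have "{n. \<ominus>\<^bsub>W n\<^esub> x n \<noteq> \<zero>\<^bsub>W n\<^esub>} \<subseteq> {n. x n \<noteq> \<zero>\<^bsub>W n\<^esub>}"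
    by auto
  then show ?thesis
    using assms by (auto simp: carrier_iff intro: finite_subset)
qed

lemma module_direct_sum: "module K A"
proof (rule moduleI)
  show "cring K" by (rule W.is_cring)
  show "abelian_group A"
  proof (rule abelian_groupI)
    show "\<exists>y\<in>carrier A. y \<oplus>\<^bsub>A\<^esub> x = \<zero>\<^bsub>A\<^esub>" if "x \<in> carrier A" for x
      using uminus_closed[OF that] that
      by (auto simp: add_eq zero_eq component_closed W.M.l_neg intro!: bexI)
  qed (auto simp: add_closed, auto simp: add_eq zero_eq carrier_iff W.M.a_ac)
qed (auto simp: smult_closed, auto simp: add_eq smult_eq component_closed
      W.smult_l_distr W.smult_r_distr W.smult_assoc1)

sublocale A: module K A
  by (rule module_direct_sum)

lemma uminus_eq: "x \<in> carrier A \<Longrightarrow> \<ominus>\<^bsub>A\<^esub> x = (\<lambda>n. \<ominus>\<^bsub>W n\<^esub> x n)"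
  by (rule A.M.minus_equality) (auto simp: uminus_closed add_eq zero_eq component_closed W.M.l_neg)

text \<open>The support of a product lies in the sumset of the two supports, which is
  finite.\<close>

lemma mult_closed:
  assumes x: "x \<in> carrier A" and y: "y \<in> carrier A"
  shows "x \<otimes>\<^bsub>A\<^esub> y \<in> carrier A"
proof -
  let ?S = "\<lambda>x. {n. x n \<noteq> \<zero>\<^bsub>W n\<^esub>}"
  have "(x \<otimes>\<^bsub>A\<^esub> y) n = \<zero>\<^bsub>W n\<^esub>" if n: "n \<notin> (\<lambda>(i, j). i + j) ` (?S x \<times> ?S y)" for n
  proof -
    have "\<mu> i (n - i) (x i) (y (n - i)) = \<zero>\<^bsub>W n\<^esub>" if "i \<le> n" for i
    proof -
      \<comment> \<open>If both components were nonzero, \<open>n = i + (n - i)\<close> would be in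
        the sumset.\<close>
      have "x i = \<zero>\<^bsub>W i\<^esub> \<or> y (n - i) = \<zero>\<^bsub>W (n - i)\<^esub>"
        using n that by (force simp: image_iff)
      then show ?thesis
        using bilinear_map.zero_left[OF bilinear[of i "n - i"] component_closed[OF y]]
          bilinear_map.zero_right[OF bilinear[of i "n - i"] component_closed[OF x]] that
        by auto
    qed
    then have "(\<Oplus>\<^bsub>W n\<^esub>i\<in>{..n}. \<mu> i (n - i) (x i) (y (n - i))) = (\<Oplus>\<^bsub>W n\<^esub>i\<in>{..n}. \<zero>\<^bsub>W n\<^esub>)"
      by (intro W.M.finsum_cong') auto
    then show ?thesis by (simp add: mult_eq)
  qed
  then have "?S (x \<otimes>\<^bsub>A\<^esub> y) \<subseteq> (\<lambda>(i, j). i + j) ` (?S x \<times> ?S y)"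
    by blast
  moreover have "finite ((\<lambda>(i, j). i + j) ` (?S x \<times> ?S y))"
    using x y by (simp add: carrier_iff)
  ultimately have "finite (?S (x \<otimes>\<^bsub>A\<^esub> y))"
    by (rule finite_subset)
  moreover have "(x \<otimes>\<^bsub>A\<^esub> y) n \<in> carrier (W n)" for n
    using x y by (auto simp: mult_eq component_closed intro!: W.M.finsum_closed product_closed)
  ultimately show ?thesis by (simp add: carrier_iff)
qed

lemma finsum_smult:
  assumes "a \<in> carrier K" "finite S" "f \<in> S \<rightarrow> carrier (W n)"
  shows "a \<odot>\<^bsub>W n\<^esub> (\<Oplus>\<^bsub>W n\<^esub>i\<in>S. f i) = (\<Oplus>\<^bsub>W n\<^esub>i\<in>S. a \<odot>\<^bsub>W n\<^esub> f i)"
  using assms(2,3)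
  by (induction S rule: finite_induct)
    (auto simp: assms(1) W.smult_r_distr Pi_def intro!: W.M.finsum_closed)

lemma bilinear_mult: "bilinear_map K A A A (\<otimes>\<^bsub>A\<^esub>)"
proof (intro bilinear_map.intro bilinear_map_axioms.intro module_direct_sum)
  fix x x' y assume [simp]: "x \<in> carrier A" "x' \<in> carrier A" "y \<in> carrier A"
  show "(x \<oplus>\<^bsub>A\<^esub> x') \<otimes>\<^bsub>A\<^esub> y = x \<otimes>\<^bsub>A\<^esub> y \<oplus>\<^bsub>A\<^esub> x' \<otimes>\<^bsub>A\<^esub> y"
  proof
    fix n
    \<comment> \<open>Bilinearity of \<open>\<mu>\<close> yields an identity in
      \<open>W (i + (n - i))\<close>; the premise \<open>i \<le> n\<close> turns this space into
      \<open>W n\<close>. The same holds for the three other laws.\<close>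
    have "\<mu> i (n - i) (x i \<oplus>\<^bsub>W i\<^esub> x' i) (y (n - i))
        = \<mu> i (n - i) (x i) (y (n - i)) \<oplus>\<^bsub>W n\<^esub> \<mu> i (n - i) (x' i) (y (n - i))" if "i \<le> n" for i
      using bilinear_map.add_left[OF bilinear[of i "n - i"], of "x i" "x' i" "y (n - i)"] that
      by (simp add: component_closed)
    then show "((x \<oplus>\<^bsub>A\<^esub> x') \<otimes>\<^bsub>A\<^esub> y) n = (x \<otimes>\<^bsub>A\<^esub> y \<oplus>\<^bsub>A\<^esub> x' \<otimes>\<^bsub>A\<^esub> y) n"
      unfolding mult_eq add_eq
      by (subst W.M.finsum_addf[symmetric])
        (auto intro!: W.M.finsum_cong' product_closed simp: component_closed)
  qed
next
  fix x y y' assume [simp]: "x \<in> carrier A" "y \<in> carrier A" "y' \<in> carrier A"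
  show "x \<otimes>\<^bsub>A\<^esub> (y \<oplus>\<^bsub>A\<^esub> y') = x \<otimes>\<^bsub>A\<^esub> y \<oplus>\<^bsub>A\<^esub> x \<otimes>\<^bsub>A\<^esub> y'"
  proof
    fix n
    have "\<mu> i (n - i) (x i) (y (n - i) \<oplus>\<^bsub>W (n - i)\<^esub> y' (n - i))
        = \<mu> i (n - i) (x i) (y (n - i)) \<oplus>\<^bsub>W n\<^esub> \<mu> i (n - i) (x i) (y' (n - i))" if "i \<le> n" for i
      using bilinear_map.add_right[OF bilinear[of i "n - i"], of "x i" "y (n - i)" "y' (n - i)"] that
      by (simp add: component_closed)
    then show "(x \<otimes>\<^bsub>A\<^esub> (y \<oplus>\<^bsub>A\<^esub> y')) n = (x \<otimes>\<^bsub>A\<^esub> y \<oplus>\<^bsub>A\<^esub> x \<otimes>\<^bsub>A\<^esub> y') n"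
      unfolding mult_eq add_eq
      by (subst W.M.finsum_addf[symmetric])
        (auto intro!: W.M.finsum_cong' product_closed simp: component_closed)
  qed
next
  fix a x y assume [simp]: "a \<in> carrier K" "x \<in> carrier A" "y \<in> carrier A"
  show "(a \<odot>\<^bsub>A\<^esub> x) \<otimes>\<^bsub>A\<^esub> y = a \<odot>\<^bsub>A\<^esub> (x \<otimes>\<^bsub>A\<^esub> y)"
  proof
    fix n
    have "\<mu> i (n - i) (a \<odot>\<^bsub>W i\<^esub> x i) (y (n - i)) = a \<odot>\<^bsub>W n\<^esub> \<mu> i (n - i) (x i) (y (n - i))"
      if "i \<le> n" for i
      using bilinear_map.smult_left[OF bilinear[of i "n - i"], of a "x i" "y (n - i)"] that
      by (simp add: component_closed)
    then show "((a \<odot>\<^bsub>A\<^esub> x) \<otimes>\<^bsub>A\<^esub> y) n = (a \<odot>\<^bsub>A\<^esub> (x \<otimes>\<^bsub>A\<^esub> y)) n"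
      unfolding mult_eq smult_eq
      by (subst finsum_smult)
        (auto intro!: W.M.finsum_cong' W.smult_closed product_closed simp: component_closed)
  qed
  show "x \<otimes>\<^bsub>A\<^esub> (a \<odot>\<^bsub>A\<^esub> y) = a \<odot>\<^bsub>A\<^esub> (x \<otimes>\<^bsub>A\<^esub> y)"
  proof
    fix n
    have "\<mu> i (n - i) (x i) (a \<odot>\<^bsub>W (n - i)\<^esub> y (n - i)) = a \<odot>\<^bsub>W n\<^esub> \<mu> i (n - i) (x i) (y (n - i))"
      if "i \<le> n" for i
      using bilinear_map.smult_right[OF bilinear[of i "n - i"], of a "x i" "y (n - i)"] that
      by (simp add: component_closed)
    then show "(x \<otimes>\<^bsub>A\<^esub> (a \<odot>\<^bsub>A\<^esub> y)) n = (a \<odot>\<^bsub>A\<^esub> (x \<otimes>\<^bsub>A\<^esub> y)) n"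
      unfolding mult_eq smult_eq
      by (subst finsum_smult)
        (auto intro!: W.M.finsum_cong' W.smult_closed product_closed simp: component_closed)
  qed
next
  show "x \<otimes>\<^bsub>A\<^esub> y \<in> carrier A" if "x \<in> carrier A" "y \<in> carrier A" for x y
    using that by (rule mult_closed)
qed

text \<open>In degree \<open>n\<close> both bracketings are sums of triple products over all degrees
  adding up to \<open>n\<close>. The left one is grouped by the joint degree of the first two
  factors, the right one by the degree of the first factor, and \<open>finsum_triangle\<close>
  exchanges these groupings.\<close>

lemma mult_assoc:
  assumes "x \<in> carrier A" "y \<in> carrier A" "z \<in> carrier A"
  shows "(x \<otimes>\<^bsub>A\<^esub> y) \<otimes>\<^bsub>A\<^esub> z = x \<otimes>\<^bsub>A\<^esub> (y \<otimes>\<^bsub>A\<^esub> z)"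
proof
  fix n
  note c = assms[THEN component_closed]
  \<comment> \<open>The triple product is bracketed to the right, so associativity of
    \<open>\<mu>\<close> is needed only for the left-hand side.\<close>
  define g where "g i j = \<mu> i (n - i) (x i) (\<mu> j (n - i - j) (y j) (z (n - i - j)))" for i j
  have g: "g i j \<in> carrier (W n)" if "i + j \<le> n" for i j
    unfolding g_def using that by (intro product_closed c) auto
  have "\<mu> k (n - k) (\<Oplus>\<^bsub>W k\<^esub>i\<in>{..k}. \<mu> i (k - i) (x i) (y (k - i))) (z (n - k))
      = (\<Oplus>\<^bsub>W n\<^esub>i\<in>{..k}. g i (k - i))" if "k \<le> n" for k
  proof -
    have "\<mu> k (n - k) (\<Oplus>\<^bsub>W k\<^esub>i\<in>{..k}. \<mu> i (k - i) (x i) (y (k - i))) (z (n - k))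
        = (\<Oplus>\<^bsub>W (k + (n - k))\<^esub>i\<in>{..k}. \<mu> k (n - k) (\<mu> i (k - i) (x i) (y (k - i))) (z (n - k)))"
      by (rule bilinear_map.finsum_left[OF bilinear]) (auto intro!: product_closed c)
    also have "\<dots> = (\<Oplus>\<^bsub>W n\<^esub>i\<in>{..k}. \<mu> k (n - k) (\<mu> i (k - i) (x i) (y (k - i))) (z (n - k)))"
      using that by simp
    also have "\<dots> = (\<Oplus>\<^bsub>W n\<^esub>i\<in>{..k}. g i (k - i))"
    proof (rule W.M.finsum_cong')
      \<comment> \<open>With \<open>j = k - i\<close> the remaining degree \<open>n - i - j\<close>
        is \<open>n - k\<close>, so associativity in degrees \<open>i\<close>, \<open>k - i\<close>,
        \<open>n - k\<close> produces exactly \<open>g i (k - i)\<close>.\<close>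
      fix i assume "i \<in> {..k}"
      then show "\<mu> k (n - k) (\<mu> i (k - i) (x i) (y (k - i))) (z (n - k)) = g i (k - i)"
        using assoc[OF c(1)[of i] c(2)[of "k - i"] c(3)[of "n - k"]] that
        by (simp add: g_def)
    qed (use g that in auto)
    finally show ?thesis .
  qed
  then have "((x \<otimes>\<^bsub>A\<^esub> y) \<otimes>\<^bsub>A\<^esub> z) n = (\<Oplus>\<^bsub>W n\<^esub>k\<in>{..n}. \<Oplus>\<^bsub>W n\<^esub>i\<in>{..k}. g i (k - i))"
    unfolding mult_eq by (intro W.M.finsum_cong') (auto intro!: W.M.finsum_closed g)
  also have "\<dots> = (\<Oplus>\<^bsub>W n\<^esub>i\<in>{..n}. \<Oplus>\<^bsub>W n\<^esub>j\<in>{..n - i}. g i j)"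
    by (rule W.M.finsum_triangle) (rule g)
  also have "\<dots> = (x \<otimes>\<^bsub>A\<^esub> (y \<otimes>\<^bsub>A\<^esub> z)) n"
  proof -
    have "\<mu> i (n - i) (x i) (\<Oplus>\<^bsub>W (n - i)\<^esub>j\<in>{..n - i}. \<mu> j (n - i - j) (y j) (z (n - i - j)))
        = (\<Oplus>\<^bsub>W n\<^esub>j\<in>{..n - i}. g i j)" if "i \<le> n" for i
    proof -
      have "\<mu> i (n - i) (x i) (\<Oplus>\<^bsub>W (n - i)\<^esub>j\<in>{..n - i}. \<mu> j (n - i - j) (y j) (z (n - i - j)))
          = (\<Oplus>\<^bsub>W (i + (n - i))\<^esub>j\<in>{..n - i}. g i j)"
        unfolding g_def
        by (rule bilinear_map.finsum_right[OF bilinear]) (auto intro!: product_closed c)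
      then show ?thesis using that by simp
    qed
    then show ?thesis
      unfolding mult_eq
      by (intro W.M.finsum_cong') (auto intro!: product_closed W.M.finsum_closed c)
  qed
  finally show "((x \<otimes>\<^bsub>A\<^esub> y) \<otimes>\<^bsub>A\<^esub> z) n = (x \<otimes>\<^bsub>A\<^esub> (y \<otimes>\<^bsub>A\<^esub> z)) n" .
qed

section \<open>The grading by homogeneous components\<close>

lemma inj_closed: "f \<in> carrier (W n) \<Longrightarrow> direct_sum_inj W n f \<in> carrier A"
  by (auto simp: carrier_iff direct_sum_inj_def intro: finite_subset[of _ "{n}"])

text \<open>Replacing the image under the injection by a condition on components makes the submodule
  laws and the uniqueness of decompositions componentwise checks.\<close>

lemma component_iff:
  "x \<in> direct_sum_component W n \<longleftrightarrow> x n \<in> carrier (W n) \<and> (\<forall>k. k \<noteq> n \<longrightarrow> x k = \<zero>\<^bsub>W k\<^esub>)"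
proof
  assume "x n \<in> carrier (W n) \<and> (\<forall>k. k \<noteq> n \<longrightarrow> x k = \<zero>\<^bsub>W k\<^esub>)"
  then have "x = direct_sum_inj W n (x n)" "x n \<in> carrier (W n)"
    by (auto simp: direct_sum_inj_def)
  then show "x \<in> direct_sum_component W n"
    unfolding direct_sum_component_def by (rule image_eqI)
qed (auto simp: direct_sum_component_def direct_sum_inj_def)

lemma component_subset: "direct_sum_component W n \<subseteq> carrier A"
  by (auto simp: direct_sum_component_def inj_closed)

lemma submodule_component: "submodule (direct_sum_component W n) K A"
proof (rule A.submoduleI)
  show "\<ominus>\<^bsub>A\<^esub> x \<in> direct_sum_component W n" if "x \<in> direct_sum_component W n" for x
    using that subsetD[OF component_subset that] by (simp add: uminus_eq component_iff)
qed (auto simp: component_subset, auto simp: component_iff add_eq zero_eq smult_eq)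

lemma finsum_apply:
  assumes "finite S" "c \<in> S \<rightarrow> carrier A"
  shows "(\<Oplus>\<^bsub>A\<^esub>n\<in>S. c n) k = (\<Oplus>\<^bsub>W k\<^esub>n\<in>S. c n k)"
  using assms
  by (induction S rule: finite_induct) (auto simp: zero_eq add_eq Pi_def component_closed)

text \<open>In degree \<open>k\<close> every summand except \<open>c k\<close> vanishes. This serves
  both halves of the decomposition: it shows that the homogeneous parts of an element add up to it,
  and it recovers a family from its sum.\<close>

lemma finsum_components:
  assumes c: "\<And>n. c n \<in> direct_sum_component W n" and fin: "finite {n. c n \<noteq> \<zero>\<^bsub>A\<^esub>}"
  shows "(\<Oplus>\<^bsub>A\<^esub>n\<in>{n. c n \<noteq> \<zero>\<^bsub>A\<^esub>}. c n) = (\<lambda>k. c k k)"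
proof
  fix k
  let ?S = "{n. c n \<noteq> \<zero>\<^bsub>A\<^esub>}"
  have ck: "c k k \<in> carrier (W k)"
    using c[of k] by (simp add: component_iff)
  have "(\<Oplus>\<^bsub>W k\<^esub>n\<in>?S. c n k) = (\<Oplus>\<^bsub>W k\<^esub>n\<in>?S. if k = n then c k k else \<zero>\<^bsub>W k\<^esub>)"
  proof (rule W.M.finsum_cong')
    show "c n k = (if k = n then c k k else \<zero>\<^bsub>W k\<^esub>)" for n
      using c[of n] by (simp add: component_iff)
  qed (use ck in auto)
  also have "\<dots> = c k k"
  proof (cases "k \<in> ?S")
    case True
    then show ?thesis
      using W.M.finsum_singleton[OF True fin, of "\<lambda>_. c k k"] ck by simp
  next
    case False
    \<comment> \<open>An index missing from the sum has \<open>c k\<close> equal to zero, so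
      \<open>c k k\<close> is zero as well.\<close>
    then have "(\<Oplus>\<^bsub>W k\<^esub>n\<in>?S. if k = n then c k k else \<zero>\<^bsub>W k\<^esub>) = (\<Oplus>\<^bsub>W k\<^esub>n\<in>?S. \<zero>\<^bsub>W k\<^esub>)"
      by (intro W.M.finsum_cong') auto
    also have "\<dots> = c k k" using False by (simp add: zero_eq)
    finally show ?thesis .
  qed
  finally show "(\<Oplus>\<^bsub>A\<^esub>n\<in>?S. c n) k = c k k"
    using finsum_apply[OF fin, of c k] by (simp add: Pi_def subsetD[OF component_subset c])
qed

lemma component_decomposition:
  assumes x: "x \<in> carrier A"
  shows "\<exists>!c. (\<forall>n. c n \<in> direct_sum_component W n) \<and> finite {n. c n \<noteq> \<zero>\<^bsub>A\<^esub>}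
    \<and> x = (\<Oplus>\<^bsub>A\<^esub>n\<in>{n. c n \<noteq> \<zero>\<^bsub>A\<^esub>}. c n)"
proof (rule ex1I)
  let ?c = "\<lambda>n. direct_sum_inj W n (x n)"
  have comp: "?c n \<in> direct_sum_component W n" for n
    using x by (simp add: direct_sum_component_def component_closed)
  have "{n. ?c n \<noteq> \<zero>\<^bsub>A\<^esub>} = {n. x n \<noteq> \<zero>\<^bsub>W n\<^esub>}"
    by (auto simp: direct_sum_inj_def zero_eq fun_eq_iff)
  then have fin: "finite {n. ?c n \<noteq> \<zero>\<^bsub>A\<^esub>}"
    using x by (simp add: carrier_iff)
  have "x = (\<Oplus>\<^bsub>A\<^esub>n\<in>{n. ?c n \<noteq> \<zero>\<^bsub>A\<^esub>}. ?c n)"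
    unfolding finsum_components[OF comp fin] by (simp add: direct_sum_inj_def)
  with comp fin show "(\<forall>n. ?c n \<in> direct_sum_component W n) \<and> finite {n. ?c n \<noteq> \<zero>\<^bsub>A\<^esub>}
      \<and> x = (\<Oplus>\<^bsub>A\<^esub>n\<in>{n. ?c n \<noteq> \<zero>\<^bsub>A\<^esub>}. ?c n)"
    by blast
next
  fix c
  assume c: "(\<forall>n. c n \<in> direct_sum_component W n) \<and> finite {n. c n \<noteq> \<zero>\<^bsub>A\<^esub>}
    \<and> x = (\<Oplus>\<^bsub>A\<^esub>n\<in>{n. c n \<noteq> \<zero>\<^bsub>A\<^esub>}. c n)"
  then have comp: "c n \<in> direct_sum_component W n" and fin: "finite {n. c n \<noteq> \<zero>\<^bsub>A\<^esub>}"
    and sum: "x = (\<Oplus>\<^bsub>A\<^esub>n\<in>{n. c n \<noteq> \<zero>\<^bsub>A\<^esub>}. c n)" for n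
    by blast+
  \<comment> \<open>The sum determines each diagonal entry \<open>c k k\<close>, and homogeneity of
    \<open>c k\<close> forces all its other entries to be zero.\<close>
  have x_eq: "x k = c k k" for k
    unfolding sum by (rule fun_cong[OF finsum_components[OF comp fin]])
  show "c = (\<lambda>n. direct_sum_inj W n (x n))"
  proof (intro ext)
    show "c n k = direct_sum_inj W n (x n) k" for n k
      using comp[of n] unfolding component_iff x_eq direct_sum_inj_def by simp
  qed
qed

lemma graded_nonunital_algebra_direct_sum:
  "graded_nonunital_algebra K A (direct_sum_component W)"
proof (intro graded_nonunital_algebra.intro nonunital_algebra.intro
    nonunital_algebra_axioms.intro graded_nonunital_algebra_axioms.intro)
  show "x \<otimes>\<^bsub>A\<^esub> y \<in> direct_sum_component W (m + n)"
    if "x \<in> direct_sum_component W m" "y \<in> direct_sum_component W n" for x y m n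
    using that
    by (auto simp: direct_sum_component_def direct_sum_mult_homogeneous[OF bilinear] product_closed)
qed (simp_all add: module_direct_sum field bilinear_mult mult_assoc submodule_component
      component_decomposition)

end

section \<open>The two products of a weak comp algebra\<close>

context weak_comp_algebra
begin

lemma comp_closed:
  assumes "f \<in> carrier (V m)" "g \<in> carrier (V n)" "k = m + n - 1"
  shows "comp m n i f g \<in> carrier (V k)"
  using bilinear_map.closed[OF comp_bilinear] assms by blast

text \<open>The product is the bilinear operation of \<open>r\<close> with its left slot precomposed
  with the linear map obtained from \<open>l\<close> by fixing \<open>\<pi>\<close>.\<close>

lemma bilinear_cup:
  "bilinear_map K (V (int m)) (V (int n)) (V (int (m + n))) (cup m n)"
proof -
  note l = comp_bilinear[of 2 "int m" 0] and r = comp_bilinear[of "int m + 1" "int n" m]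
  show ?thesis
    using bilinear_map.closed[OF l pi_degree] bilinear_map.closed[OF r]
      bilinear_map.add_right[OF l pi_degree] bilinear_map.smult_right[OF l _ pi_degree]
      bilinear_map.add_left[OF r] bilinear_map.add_right[OF r]
      bilinear_map.smult_left[OF r] bilinear_map.smult_right[OF r]
    by (intro bilinear_map.intro bilinear_map_axioms.intro vector_space)
      (auto simp: cup_def add.commute)
qed

text \<open>The factors enter in reverse order: linearity in the first factor comes from the right
  slot of \<open>r\<close>, linearity in the second from \<open>l\<close> and the left slot.\<close>

lemma bilinear_sqcup:
  "bilinear_map K (V (int m)) (V (int n)) (V (int (m + n))) (sqcup m n)"
proof -
  note l = comp_bilinear[of 2 "int n" 1] and r = comp_bilinear[of "int n + 1" "int m" 0]
  show ?thesis
    using bilinear_map.closed[OF l pi_degree] bilinear_map.closed[OF r]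
      bilinear_map.add_right[OF l pi_degree] bilinear_map.smult_right[OF l _ pi_degree]
      bilinear_map.add_left[OF r] bilinear_map.add_right[OF r]
      bilinear_map.smult_left[OF r] bilinear_map.smult_right[OF r]
    by (intro bilinear_map.intro bilinear_map_axioms.intro vector_space)
      (auto simp: sqcup_def add.commute)
qed

lemma cup_assoc:
  assumes f: "f \<in> carrier (V (int m))" and g: "g \<in> carrier (V (int n))"
    and h: "h \<in> carrier (V (int p))"
  shows "cup (m + n) p (cup m n f g) h = cup m (n + p) f (cup n p g h)"
proof -
  define F where "F = comp 2 (int m) 0 \<pi> f"
  define G where "G = comp 2 (int n) 0 \<pi> g"
  have pi: "\<pi> \<in> carrier (V (int 2))" using pi_degree by simp
  have F: "F \<in> carrier (V (int (m + 1)))" and G: "G \<in> carrier (V (int (n + 1)))"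
    unfolding F_def G_def using pi_degree f g by (auto intro!: comp_closed)
  have "comp 2 (int (m + 1)) 0 \<pi> F = comp 3 (int m) 0 (comp 2 2 0 \<pi> \<pi>) f"
    using comp_assoc[OF pi pi f, of 0 0] by (simp add: F_def add.commute)
  \<comment> \<open>Moving the inner index from 0 to 1 by \<open>pi_comp_pi\<close> makes axiom (3)
    applicable with \<open>j = 0 < i = 1\<close>; the resulting index is
    \<open>1 + m - 1 = m\<close>.\<close>
  also have "\<dots> = comp (int (m + 1)) 2 m F \<pi>"
    using comp_commute[OF pi pi f, of 0 1] by (simp add: F_def pi_comp_pi add.commute)
  finally have piF: "comp 2 (int (m + 1)) 0 \<pi> F = comp (int (m + 1)) 2 m F \<pi>" .
  have "comp 2 (int (m + n)) 0 \<pi> (comp (int (m + 1)) (int n) m F g)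
      = comp (int (m + 2)) (int n) m (comp 2 (int (m + 1)) 0 \<pi> F) g"
    using comp_assoc[OF pi F g, of 0 m] by (simp add: algebra_simps)
  also have "\<dots> = comp (int (m + 1)) (int (n + 1)) m F G"
    unfolding piF using comp_assoc[OF F pi g, of m m] by (simp add: G_def algebra_simps)
  finally have "cup (m + n) p (cup m n f g) h
      = comp (int (m + n + 1)) (int p) (m + n) (comp (int (m + 1)) (int (n + 1)) m F G) h"
    by (simp add: cup_def F_def algebra_simps)
  \<comment> \<open>Since \<open>G\<close> has degree \<open>n + 1\<close>, the index
    \<open>m + n\<close> is the last one that axiom (2) admits here. The inner term is the product
    of \<open>g\<close> and \<open>h\<close>.\<close>
  also have "\<dots> = comp (int (m + 1)) (int (n + p)) m F (comp (int (n + 1)) (int p) n G h)"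
    using comp_assoc[OF F G h, of m "m + n"] by (simp add: algebra_simps)
  finally show ?thesis
    by (simp add: cup_def F_def G_def algebra_simps)
qed

text \<open>As \<open>sqcup\<close> is built from its right factor, the reduction starts with the
  right bracketing; both sides become
  \<open>(H \<diamond>\<^sub>0 G) \<diamond>\<^sub>0 f\<close>.\<close>

lemma sqcup_assoc:
  assumes f: "f \<in> carrier (V (int m))" and g: "g \<in> carrier (V (int n))"
    and h: "h \<in> carrier (V (int p))"
  shows "sqcup (m + n) p (sqcup m n f g) h = sqcup m (n + p) f (sqcup n p g h)"
proof -
  define G where "G = comp 2 (int n) 1 \<pi> g"
  define H where "H = comp 2 (int p) 1 \<pi> h"
  have pi: "\<pi> \<in> carrier (V (int 2))" using pi_degree by simp
  have G: "G \<in> carrier (V (int (n + 1)))" and H: "H \<in> carrier (V (int (p + 1)))"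
    unfolding G_def H_def using pi_degree g h by (auto intro!: comp_closed)
  have "comp 2 (int (p + 1)) 1 \<pi> H = comp 3 (int p) 2 (comp 2 2 1 \<pi> \<pi>) h"
    using comp_assoc[OF pi pi h, of 1 2] by (simp add: H_def add.commute)
  \<comment> \<open>Axiom (3) is read from right to left, with \<open>\<pi>\<close> as its last
    element: the index 2 arises as \<open>1 + 2 - 1\<close>.\<close>
  also have "\<dots> = comp (int (p + 1)) 2 0 H \<pi>"
    using comp_commute[OF pi h pi, of 0 1] by (simp add: H_def pi_comp_pi numeral_2_eq_2 add.commute)
  finally have piH: "comp 2 (int (p + 1)) 1 \<pi> H = comp (int (p + 1)) 2 0 H \<pi>" .
  have "comp 2 (int (n + p)) 1 \<pi> (comp (int (p + 1)) (int n) 0 H g)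
      = comp (int (p + 2)) (int n) 1 (comp 2 (int (p + 1)) 1 \<pi> H) g"
    using comp_assoc[OF pi H g, of 1 1] by (simp add: algebra_simps)
  also have "\<dots> = comp (int (p + 1)) (int (n + 1)) 0 H G"
    unfolding piH using comp_assoc[OF H pi g, of 0 1] by (simp add: G_def algebra_simps)
  finally have "sqcup m (n + p) f (sqcup n p g h)
      = comp (int (n + p + 1)) (int m) 0 (comp (int (p + 1)) (int (n + 1)) 0 H G) f"
    by (simp add: sqcup_def H_def algebra_simps)
  also have "\<dots> = comp (int (p + 1)) (int (m + n)) 0 H (comp (int (n + 1)) (int m) 0 G f)"
    using comp_assoc[OF H G f, of 0 0] by (simp add: algebra_simps)
  finally show ?thesis
    by (simp add: sqcup_def G_def H_def algebra_simps)
qed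

lemma graded_product_cup: "graded_product K (\<lambda>n. V (int n)) cup"
  by (intro graded_product.intro field bilinear_cup cup_assoc)

lemma graded_product_sqcup: "graded_product K (\<lambda>n. V (int n)) sqcup"
  by (intro graded_product.intro field bilinear_sqcup sqcup_assoc)

end

theorem proposition4p5:
  fixes K :: "('k, 'r) ring_scheme"
    and V :: "int \<Rightarrow> ('k, 'v) module"
    and comp :: "int \<Rightarrow> int \<Rightarrow> nat \<Rightarrow> 'v \<Rightarrow> 'v \<Rightarrow> 'v"
    and \<pi> :: 'v
  assumes "weak_comp_algebra K V comp \<pi>"
  shows "graded_nonunital_algebra K
      (direct_sum_algebra (\<lambda>n. V (int n)) (weak_comp_algebra.cup comp \<pi>))
      (direct_sum_component (\<lambda>n. V (int n)))
    \<and> graded_nonunital_algebra K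
      (direct_sum_algebra (\<lambda>n. V (int n)) (weak_comp_algebra.sqcup comp \<pi>))
      (direct_sum_component (\<lambda>n. V (int n)))"
proof -
  interpret weak_comp_algebra K V comp \<pi>
    by (rule assms)
  show ?thesis
    using graded_product.graded_nonunital_algebra_direct_sum[OF graded_product_cup]
      graded_product.graded_nonunital_algebra_direct_sum[OF graded_product_sqcup] ..
qed

end
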